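(* Let $(Y,\|\cdot\|)$ be a Banach space and $K\subseteq Y$ a closed, convex and pointed cone with nonempty interior. Let $G,H$ be nonempty $w^*$-compact convex subsets of $Y^*$. Then: (i) $G$ is a $w^*$-compact generator of $K^*$ if and only if $[G,\{0\}]\in\mathbb{S}(K)$. In particular, $\Omega_{DS}\subseteq\Omega_{QD}$. (ii) Assume that $[G,H]\in\mathbb{S}(K)$ and let $\Psi:=\sigma_G-\sigma_H$. Then $\Psi\in\Omega_{DS}$ if and only if $H+(G\ominus H)=G$. In particular, in this case the set $G\ominus H$ is necessarily a generator of $K^*$.
   Context: Spaces are real; $Y^*$ is the topological dual. A cone is a set $C$ with $tx\in C$ for all $x\in C$, $t\ge 0$. $K^*=\{y^*\in Y^*:\langle y^*,y\rangle\ge 0\ \forall y\in K\}$; $\operatorname{int}$ of a subset of $Y^*$ is the norm interior. For $A\subseteq Y^*$, $\sigma_A(y):=\sup_{y^*\in A}\langle y^*,y\rangle$, and for $y\in Y$ the $y$-face of $A$ is $A^y:=\{y^*\in A:\langle y^*,y\rangle=\sigma_A(y)\}$. $G\ominus H:=\{y^*\in Y^*: y^*+H\subseteq G\}$. For $A,B\subseteq Y^*$: $A\preceq_l^{K^*}B$ iff $B\subseteq A+K^*$; $A\preceq_u^{K^*}B$ iff $A\subseteq B-K^*$; $A\preceq_s^{K^*}B$ iff both hold. For $y\in Y$, $P(y):=\{y^*\in Y^*:\langle y^*,y\rangle\ge 0\}$. For nonempty convex $w^*$-compact $G,H\subseteq Y^*$, the pair $[G,H]$ is a scalarization pair, written $[G,H]\in\mathbb{S}(K)$,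 if (i) $H^y\preceq_s^{K^*}G^y$ for every $y\in Y$; (ii) $H\cap G=\emptyset$; (iii) $H\subseteq\bigcap_{y\notin -K}\left(G-\operatorname{int}(P(y))\right)$. $\Omega_{QD}:=\{\Psi:Y\to\mathbb{R}\ :\ \exists\,[G,H]\in\mathbb{S}(K)\text{ with }\Psi=\sigma_G-\sigma_H\}$. $\Omega_{DS}$ is the set of all functionals $\Psi_G=\sigma_G$, where $G$ ranges over the $w^*$-compact generators of $K^*$; $G\subseteq Y^*$ is a generator of $K^*$ if $G$ is convex, $0$ is not in the $w^*$-closure of $G$, and $K^*=\{ty^*:t\ge 0,\ y^*\in G\}$. *)

theory Defs
  imports "HOL-Analysis.Analysis"
begin

text \<open>
  The topological dual of \<open>Y\<close> is the type \<open>Y \<Rightarrow>\<^sub>L real\<close> with the operator norm, so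
  \<^const>\<open>interior\<close> of a set of functionals is its norm interior. Its topology of pointwise
  convergence, \<^const>\<open>strong_operator_topology\<close>, is for real-valued functionals the weak-star
  topology.
  On sets, \<open>A + B\<close> is the Minkowski sum, but \<open>A - B\<close> is the set difference and unary minus is the
  complement. Negated sets are therefore written with \<open>uminus `\<close>, and Minkowski differences with
  \<open>minkowski_diff\<close>.
\<close>

abbreviation weak_star_topology :: "('a::real_normed_vector \<Rightarrow>\<^sub>L real) topology" where
  "weak_star_topology \<equiv> strong_operator_topology"

definition pointed :: "'a::real_vector set \<Rightarrow> bool" where
  "pointed C \<longleftrightarrow> C \<inter> uminus ` C = {0}"

definition dual_cone :: "'a::real_normed_vector set \<Rightarrow> ('a \<Rightarrow>\<^sub>L real) set" where
  "dual_cone K = {f. \<forall>y\<in>K. blinfun_apply f y \<ge> 0}"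

definition minkowski_diff :: "'b::group_add set \<Rightarrow> 'b set \<Rightarrow> 'b set"  (infixl \<open>\<ominus>\<^sub>M\<close> 65) where
  "A \<ominus>\<^sub>M B = {a - b |a b. a \<in> A \<and> b \<in> B}"

text \<open>The operation \<open>G \<ominus> H\<close>, the set of all translations taking \<open>H\<close> into \<open>G\<close>.\<close>

definition star_diff :: "'b::plus set \<Rightarrow> 'b set \<Rightarrow> 'b set"  (infixl \<open>\<ominus>\<^sub>*\<close> 65) where
  "G \<ominus>\<^sub>* H = {f. (\<lambda>h. f + h) ` H \<subseteq> G}"

text \<open>
  The supremum is taken in the reals. It is only meaningful for nonempty, pointwise bounded sets of
  functionals, such as the nonempty weak-star compact ones.
\<close>

definition support_fun :: "('a::real_normed_vector \<Rightarrow>\<^sub>L real) set \<Rightarrow> 'a \<Rightarrow> real" where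
  "support_fun A y = (SUP f\<in>A. blinfun_apply f y)"

definition face :: "('a::real_normed_vector \<Rightarrow>\<^sub>L real) set \<Rightarrow> 'a \<Rightarrow> ('a \<Rightarrow>\<^sub>L real) set" where
  "face A y = {f \<in> A. blinfun_apply f y = support_fun A y}"

text \<open>The set order relations with respect to a cone \<open>C\<close>, here used with \<open>C = dual_cone K\<close>.\<close>

definition lower_le :: "'b::group_add set \<Rightarrow> 'b set \<Rightarrow> 'b set \<Rightarrow> bool" where
  "lower_le C A B \<longleftrightarrow> B \<subseteq> A + C"

definition upper_le :: "'b::group_add set \<Rightarrow> 'b set \<Rightarrow> 'b set \<Rightarrow> bool" where
  "upper_le C A B \<longleftrightarrow> A \<subseteq> B \<ominus>\<^sub>M C"

definition set_le :: "'b::group_add set \<Rightarrow> 'b set \<Rightarrow> 'b set \<Rightarrow> bool" where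
  "set_le C A B \<longleftrightarrow> lower_le C A B \<and> upper_le C A B"

definition nonneg_functionals :: "'a::real_normed_vector \<Rightarrow> ('a \<Rightarrow>\<^sub>L real) set" where
  "nonneg_functionals y = {f. blinfun_apply f y \<ge> 0}"

definition scalarization_pairs ::
    "'a::real_normed_vector set \<Rightarrow> (('a \<Rightarrow>\<^sub>L real) set \<times> ('a \<Rightarrow>\<^sub>L real) set) set" where
  "scalarization_pairs K = {(G, H).
     G \<noteq> {} \<and> convex G \<and> compactin weak_star_topology G \<and>
     H \<noteq> {} \<and> convex H \<and> compactin weak_star_topology H \<and>
     (\<forall>y. set_le (dual_cone K) (face H y) (face G y)) \<and>
     H \<inter> G = {} \<and>
     H \<subseteq> (\<Inter>y\<in>{y. y \<notin> uminus ` K}. G \<ominus>\<^sub>M interior (nonneg_functionals y))}"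

definition generator :: "'a::real_normed_vector set \<Rightarrow> ('a \<Rightarrow>\<^sub>L real) set \<Rightarrow> bool" where
  "generator K G \<longleftrightarrow> convex G \<and> 0 \<notin> weak_star_topology closure_of G \<and>
     dual_cone K = {t *\<^sub>R f |t f. t \<ge> 0 \<and> f \<in> G}"

definition Omega_QD :: "'a::real_normed_vector set \<Rightarrow> ('a \<Rightarrow> real) set" where
  "Omega_QD K = {\<Psi>. \<exists>G H. (G, H) \<in> scalarization_pairs K \<and>
     \<Psi> = (\<lambda>y. support_fun G y - support_fun H y)}"

definition Omega_DS :: "'a::real_normed_vector set \<Rightarrow> ('a \<Rightarrow> real) set" where
  "Omega_DS K = {support_fun G |G. compactin weak_star_topology G \<and> generator K G}"

end

theory Submission
  imports Defs
begin

text \<open>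
  A weak-star compact convex \<open>G \<noteq> {}\<close> is a generator of the dual cone iff it lies in the dual
  cone, omits \<open>0\<close>, and meets \<open>{g. g y > 0}\<close> for every \<open>y \<notin> - K\<close>; these are the three conditions
  on the pair \<open>(G, {0})\<close>. For necessity \<open>K\<close> is separated from \<open>- y\<close>. For sufficiency, given
  \<open>f \<noteq> 0\<close> in the dual cone, compactness of \<open>G\<close> and an interior point of \<open>K\<close> yield an element of
  \<open>G\<close> that vanishes on the kernel of \<open>f\<close> and is therefore a positive multiple of \<open>f\<close>.

  Support functions of weak-star compact convex sets are additive and determine the set. Hence
  \<open>\<sigma>\<^sub>G - \<sigma>\<^sub>H = \<sigma>\<^sub>D\<close> means \<open>H + D = G\<close>, and this forces \<open>D = G \<ominus>\<^sub>* H\<close>.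
\<close>

section \<open>Positive functionals on ordered normed spaces\<close>

text \<open>Rescaling a ball around \<open>e\<close> shows that \<open>z + t *\<^sub>R e\<close>
  lies in the cone once \<open>norm z / t\<close> is below its radius. The bound is linear in
  \<open>norm z\<close>, which later gives boundedness of functionals.\<close>

lemma convex_cone_order_unit:
  fixes C :: "'a::real_normed_vector set"
  assumes C: "convex_cone C" and e: "e \<in> interior C"
  obtains b where "b > 0" "\<And>z t. b * norm z \<le> t \<Longrightarrow> z + t *\<^sub>R e \<in> C"
proof -
  obtain r where r: "r > 0" "ball e r \<subseteq> C"
    using e mem_interior by blast
  have eC: "e \<in> C"
    using e interior_subset by blast
  \<comment> \<open>The factor 2 keeps \<open>norm z / t\<close> strictly below \<open>r\<close>,
    since the ball is open.\<close>
  have "z + t *\<^sub>R e \<in> C" if t: "2 / r * norm z \<le> t" for z t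
  proof (cases "z = 0")
    case True
    then show ?thesis
      using t eC C by (simp add: convex_cone_scaleR)
  next
    case False
    then have tpos: "t > 0"
      using t r by (smt (verit) divide_pos_pos mult_pos_pos zero_less_norm_iff)
    have "norm z * 2 \<le> t * r"
      using t r by (simp add: field_simps)
    moreover have "norm z > 0"
      using False by simp
    ultimately have "norm z < r * t"
      unfolding mult.commute[of r t] by linarith
    then have "norm z / t < r"
      using tpos by (simp add: divide_less_eq)
    then have "e + (1 / t) *\<^sub>R z \<in> ball e r"
      using tpos by (simp add: dist_norm)
    then have "t *\<^sub>R (e + (1 / t) *\<^sub>R z) \<in> C"
      using r C tpos by (intro convex_cone_scaleR) auto
    then show ?thesis
      using tpos by (simp add: scaleR_add_right add.commute)
  qed
  then show thesis
    using r that[of "2 / r"] by simp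
qed

section \<open>Enlarging convex cones: adjoining a ray, and maximal cones omitting a point\<close>

lemma convex_cone_add_ray:
  fixes M :: "'a::real_vector set"
  assumes M: "convex_cone M"
  shows "convex_cone {m + t *\<^sub>R z |m t. m \<in> M \<and> t \<ge> 0}" (is "convex_cone ?X")
    and "M \<subseteq> {m + t *\<^sub>R z |m t. m \<in> M \<and> t \<ge> 0}"
proof -
  show "convex_cone ?X"
    unfolding convex_cone_iff
  proof (intro conjI ballI allI impI)
    show "0 \<in> ?X"
      using convex_cone_contains_0[OF M] by force
  next
    fix x y assume "x \<in> ?X" "y \<in> ?X"
    then obtain m s m' s' where "x = m + s *\<^sub>R z" "y = m' + s' *\<^sub>R z"
      "m \<in> M" "m' \<in> M" "s \<ge> 0" "s' \<ge> 0"
      by auto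
    then have "x + y = (m + m') + (s + s') *\<^sub>R z" "m + m' \<in> M" "s + s' \<ge> 0"
      using M by (auto simp: algebra_simps convex_cone_add)
    then show "x + y \<in> ?X"
      by blast
  next
    fix x and c :: real assume "x \<in> ?X" "0 \<le> c"
    then obtain m s where "x = m + s *\<^sub>R z" "m \<in> M" "s \<ge> 0"
      by auto
    then have "c *\<^sub>R x = c *\<^sub>R m + (c * s) *\<^sub>R z" "c *\<^sub>R m \<in> M" "c * s \<ge> 0"
      using M \<open>0 \<le> c\<close> by (auto simp: algebra_simps convex_cone_scaleR)
    then show "c *\<^sub>R x \<in> ?X"
      by blast
  qed
  show "M \<subseteq> ?X"
  proof
    fix m assume "m \<in> M"
    then have "m + 0 *\<^sub>R z \<in> ?X"
      by blast
    then show "m \<in> ?X" by simp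
  qed
qed

text \<open>Zorn's lemma applies because the union of a chain of convex cones is again one.
  Maximality is recorded in a usable form: adjoining the ray of any outside \<open>z\<close> must
  capture \<open>p\<close>, and with a coefficient \<open>t > 0\<close> since \<open>p\<close> is
  not in \<open>M\<close> itself.\<close>

lemma convex_cone_maximal_omitting:
  fixes C :: "'a::real_vector set"
  assumes C: "convex_cone C" and p: "p \<notin> C"
  obtains M where "convex_cone M" "C \<subseteq> M" "p \<notin> M" "\<And>z. z \<notin> M \<Longrightarrow> \<exists>m\<in>M. \<exists>t>0. p = m + t *\<^sub>R z"
proof -
  define \<A> where "\<A> = {M. convex_cone M \<and> C \<subseteq> M \<and> p \<notin> M}"
  have "\<exists>M\<in>\<A>. \<forall>X\<in>\<A>. M \<subseteq> X \<longrightarrow> X = M"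
  proof (rule subset_Zorn_nonempty)
    show "\<A> \<noteq> {}"
      using assms by (auto simp: \<A>_def)
    fix \<C> assume ne: "\<C> \<noteq> {}" and ch: "subset.chain \<A> \<C>"
    then have sub: "\<C> \<subseteq> \<A>" and tot: "\<And>X Y. X \<in> \<C> \<Longrightarrow> Y \<in> \<C> \<Longrightarrow> X \<subseteq> Y \<or> Y \<subseteq> X"
      by (auto simp: subset_chain_def)
    have "x + y \<in> \<Union>\<C>" if xy: "x \<in> \<Union>\<C>" "y \<in> \<Union>\<C>" for x y
    proof -
      obtain X' Y' where "X' \<in> \<C>" "x \<in> X'" "Y' \<in> \<C>" "y \<in> Y'"
        using xy by blast
      then obtain X where "X \<in> \<C>" "x \<in> X" "y \<in> X"
        using tot[of X' Y'] by blast
      moreover from this have "convex_cone X"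
        using sub by (auto simp: \<A>_def)
      ultimately show ?thesis
        using convex_cone_add by blast
    qed
    moreover have "c *\<^sub>R x \<in> \<Union>\<C>" if "x \<in> \<Union>\<C>" "c \<ge> 0" for x c
      using that sub convex_cone_scaleR unfolding \<A>_def by blast
    moreover have "0 \<in> \<Union>\<C>"
      using ne sub convex_cone_contains_0 unfolding \<A>_def by blast
    ultimately have "convex_cone (\<Union>\<C>)"
      by (auto simp: convex_cone_iff)
    then show "\<Union>\<C> \<in> \<A>"
      using ne sub unfolding \<A>_def by blast
  qed
  then obtain M where M: "convex_cone M" "C \<subseteq> M" "p \<notin> M"
    and max: "\<And>X. convex_cone X \<Longrightarrow> C \<subseteq> X \<Longrightarrow> p \<notin> X \<Longrightarrow> M \<subseteq> X \<Longrightarrow> X = M"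
    by (auto simp: \<A>_def)
  have "\<exists>m\<in>M. \<exists>t>0. p = m + t *\<^sub>R z" if z: "z \<notin> M" for z
  proof -
    define X where "X = {m + t *\<^sub>R z |m t. m \<in> M \<and> t \<ge> 0}"
    have X: "convex_cone X" and MX: "M \<subseteq> X"
      unfolding X_def using convex_cone_add_ray[OF M(1)] by blast+
    have "0 + 1 *\<^sub>R z \<in> X"
      unfolding X_def using M(1) convex_cone_contains_0 by fastforce
    then have "p \<in> X"
      using max[OF X _ _ MX] M(2) MX z by auto
    then obtain m t where "m \<in> M" "t \<ge> 0" "p = m + t *\<^sub>R z"
      by (auto simp: X_def)
    moreover from this have "t \<noteq> 0"
      using M(3) by auto
    ultimately show ?thesis
      by (metis less_eq_real_def)
  qed
  then show thesis
    using M that by blast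
qed

text \<open>The functional is read off a maximal convex cone \<open>M\<close> omitting \<open>- e\<close>: such an \<open>M\<close> contains
  \<open>z\<close> or \<open>- z\<close> for every \<open>z\<close>, so each \<open>z\<close> determines a cut of the reals.\<close>

lemma positive_functional_exists:
  fixes C :: "'a::real_normed_vector set"
  assumes C: "convex_cone C" and e: "e \<in> interior C" and ne: "- e \<notin> C"
  obtains f :: "'a \<Rightarrow>\<^sub>L real" where "\<And>x. x \<in> C \<Longrightarrow> f x \<ge> 0" "f e = 1"
proof -
  obtain M where M: "convex_cone M" "C \<subseteq> M" "- e \<notin> M"
    and max: "\<And>z. z \<notin> M \<Longrightarrow> \<exists>m\<in>M. \<exists>t>0. - e = m + t *\<^sub>R z"
    using convex_cone_maximal_omitting[OF C ne] by blast
  obtain b where b: "b > 0" "\<And>z t. b * norm z \<le> t \<Longrightarrow> z + t *\<^sub>R e \<in> C"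
    using convex_cone_order_unit[OF C e] by blast
  have eM: "t *\<^sub>R e \<in> M" if "t \<ge> 0" for t
    using b(2)[of 0 t] that M(2) by auto
  have neM: "- (t *\<^sub>R e) \<notin> M" if "t > 0" for t
  proof
    assume "- (t *\<^sub>R e) \<in> M"
    then have "(1 / t) *\<^sub>R (- (t *\<^sub>R e)) \<in> M"
      using M(1) that by (intro convex_cone_scaleR) auto
    then show False
      using that M(3) by simp
  qed
  \<comment> \<open>If \<open>M\<close> omitted both \<open>z\<close> and \<open>- z\<close>,
    eliminating \<open>z\<close> from the two resulting representations of \<open>- e\<close> would
    put a negative multiple of \<open>e\<close> into \<open>M\<close>.\<close>
  have total: "- z \<in> M" if z: "z \<notin> M" for z
  proof (rule ccontr)
    assume "- z \<notin> M"
    then obtain m s m' t where *: "m \<in> M" "m' \<in> M" "s > 0" "t > 0"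
      "- e = m + s *\<^sub>R z" "- e = m' + t *\<^sub>R (- z)"
      using max[OF z] max by metis
    have "t *\<^sub>R m + s *\<^sub>R m' = t *\<^sub>R (- e - s *\<^sub>R z) + s *\<^sub>R (- e - t *\<^sub>R (- z))"
      using * by (metis add_diff_cancel_right')
    also have "\<dots> = - ((t + s) *\<^sub>R e)"
      by (simp add: algebra_simps)
    finally show False
      using neM[of "t + s"] * M(1) by (metis add_pos_pos convex_cone_add convex_cone_scaleR less_imp_le)
  qed
  \<comment> \<open>\<open>S z\<close> is the lower part of the cut: the \<open>t\<close> for which
    \<open>t *\<^sub>R e\<close> lies below \<open>z\<close> in the preorder with positive cone
    \<open>M\<close>.\<close>
  define S where "S z = {t. z - t *\<^sub>R e \<in> M}" for z
  define f where "f z = Sup (S z)" for z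
  have S_add: "s + t \<in> S (z + w)" if "s \<in> S z" "t \<in> S w" for s t z w
  proof -
    have "(z - s *\<^sub>R e) + (w - t *\<^sub>R e) \<in> M"
      using that M(1) by (auto simp: S_def intro: convex_cone_add)
    then show ?thesis
      by (simp add: S_def algebra_simps)
  qed
  have S0: "t \<le> 0" if "t \<in> S 0" for t
    using that neM[of t] by (force simp: S_def)
  have S_lower: "- (b * norm z) \<in> S z" for z
    using b(2)[of z "b * norm z"] M(2) by (auto simp: S_def)
  have S_upper: "t \<le> b * norm z" if "t \<in> S z" for t z
    using S0[of "t + - (b * norm (- z))"] S_add[OF that S_lower[of "- z"]] by simp
  have bdd: "bdd_above (S z)" for z
    using S_upper by (auto simp: bdd_above_def)
  have le_f: "t \<le> f z" if "t \<in> S z" for t z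
    unfolding f_def using that bdd by (rule cSup_upper)
  have f_le: "f z \<le> c" if "\<And>t. t \<in> S z \<Longrightarrow> t \<le> c" for z c
    unfolding f_def using S_lower that by (intro cSup_least) auto
  have super: "f z + f w \<le> f (z + w)" for z w
  proof -
    have "f z \<le> f (z + w) - f w"
    proof (rule f_le)
      fix s assume s: "s \<in> S z"
      have "f w \<le> f (z + w) - s"
        using le_f[OF S_add[OF s]] by (intro f_le) (simp add: algebra_simps)
      then show "s \<le> f (z + w) - f w" by simp
    qed
    then show ?thesis by simp
  qed
  \<comment> \<open>Totality of \<open>M\<close> enters here: just above the supremum,
    \<open>z - t *\<^sub>R e\<close> leaves \<open>M\<close>, so its negative lies in
    \<open>M\<close>. This bound makes \<open>f\<close> odd, and oddness turns superadditivity into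
    additivity.\<close>
  have neg_ge: "- f z \<le> f (- z)" for z
  proof (rule field_le_epsilon)
    fix \<epsilon> :: real assume "\<epsilon> > 0"
    then have "f z + \<epsilon> \<notin> S z"
      using le_f[of "f z + \<epsilon>" z] by auto
    then have "- (z - (f z + \<epsilon>) *\<^sub>R e) \<in> M"
      by (intro total) (simp add: S_def)
    then have "- (f z + \<epsilon>) \<in> S (- z)"
      by (simp add: S_def algebra_simps)
    then show "- f z \<le> f (- z) + \<epsilon>"
      using le_f by fastforce
  qed
  have neg: "f (- z) = - f z" for z
    using neg_ge[of z] super[of z "- z"] f_le[of 0 0] S0 by force
  have add: "f (z + w) = f z + f w" for z w
    using super[of z w] super[of "- z" "- w"] neg[of "z + w"] neg[of z] neg[of w] by simp
  have scale_le: "c * f z \<le> f (c *\<^sub>R z)" if "c > 0" for c z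
  proof -
    have "f z \<le> f (c *\<^sub>R z) / c"
    proof (rule f_le)
      fix t assume "t \<in> S z"
      then have "c *\<^sub>R (z - t *\<^sub>R e) \<in> M"
        using M(1) that by (auto simp: S_def intro: convex_cone_scaleR)
      then have "c * t \<in> S (c *\<^sub>R z)"
        by (simp add: S_def algebra_simps)
      then show "t \<le> f (c *\<^sub>R z) / c"
        using le_f that by (simp add: field_simps)
    qed
    then show ?thesis
      using that by (simp add: field_simps)
  qed
  \<comment> \<open>The reverse inequality is \<open>scale_le\<close> for the factor
    \<open>1 / c\<close> at \<open>c *\<^sub>R z\<close>.\<close>
  have scale_pos: "f (c *\<^sub>R z) = c * f z" if "c > 0" for c z
    using scale_le[OF that, of z] scale_le[of "1 / c" "c *\<^sub>R z"] that by (simp add: field_simps)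
  have scale: "f (c *\<^sub>R z) = c * f z" for c z
  proof (cases "c = 0")
    case True
    then show ?thesis
      using neg[of 0] by simp
  next
    case False
    then show ?thesis
      using scale_pos[of c z] scale_pos[of "- c" z] neg[of "(- c) *\<^sub>R z"] by (cases "c > 0") auto
  qed
  have bound: "norm (f z) \<le> norm z * b" for z
    using f_le[of z "b * norm z"] S_upper le_f[OF S_lower[of z]] by (auto simp: abs_le_iff mult.commute)
  have "bounded_linear f"
    using bound by (intro bounded_linear_intro[where K = b]) (auto simp: add scale)
  then have F: "blinfun_apply (Blinfun f) = f"
    by (rule bounded_linear_Blinfun_apply)
  have nonneg: "f x \<ge> 0" if "x \<in> C" for x
    using le_f[of 0 x] that M(2) by (auto simp: S_def)
  have "f e = 1"
  proof (rule antisym)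
    show "1 \<le> f e"
      using le_f[of 1 e] eM[of 0] by (auto simp: S_def)
    have "t \<le> 1" if "t \<in> S e" for t
      using S0[of "t - 1"] that by (simp add: S_def algebra_simps)
    then show "f e \<le> 1"
      by (rule f_le)
  qed
  then show thesis
    using that[of "Blinfun f"] nonneg F by simp
qed

text \<open>A functional that is nonnegative on the cone spanned by \<open>K\<close> and
  \<open>- x'\<close>, with \<open>x' = x + \<epsilon> *\<^sub>R e\<close> still outside
  \<open>K\<close>, satisfies \<open>f x' \<le> 0\<close>; the normalization \<open>f e = 1\<close>
  then gives \<open>f x \<le> - \<epsilon>\<close>.\<close>

lemma dual_cone_separates:
  fixes K :: "'a::real_normed_vector set"
  assumes K: "convex_cone K" "closed K" and e: "e \<in> interior K" and x: "x \<notin> K"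
  obtains f where "f \<in> dual_cone K" "blinfun_apply f x < 0"
proof -
  \<comment> \<open>Closedness of \<open>K\<close> leaves room to move from \<open>x\<close> towards
    \<open>e\<close>; this room is what makes the final inequality strict.\<close>
  have "open (- K)" using K by auto
  moreover have "((\<lambda>t::real. x + t *\<^sub>R e) \<longlongrightarrow> x + 0 *\<^sub>R e) (at_right 0)"
    by (intro tendsto_intros)
  ultimately have "eventually (\<lambda>t. x + t *\<^sub>R e \<in> - K) (at_right 0)"
    using x by (intro topological_tendstoD) auto
  then have "eventually (\<lambda>t. x + t *\<^sub>R e \<in> - K \<and> t > 0) (at_right 0)"
    using eventually_at_right_less by (rule eventually_conj)
  then obtain \<epsilon> where \<epsilon>: "x + \<epsilon> *\<^sub>R e \<notin> K" "\<epsilon> > 0"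
    using eventually_happens[of _ "at_right (0::real)"] by auto
  define x' where "x' = x + \<epsilon> *\<^sub>R e"
  have eK: "e \<in> K"
    using e interior_subset by blast
  obtain b where b: "b > 0" "\<And>z t. b * norm z \<le> t \<Longrightarrow> z + t *\<^sub>R e \<in> K"
    using convex_cone_order_unit[OF K(1) e] by blast
  \<comment> \<open>With both \<open>e\<close> and \<open>- e\<close> in \<open>K\<close>, the order
    unit property would place \<open>x\<close> in \<open>K\<close>.\<close>
  have ne: "- e \<notin> K"
  proof
    assume "- e \<in> K"
    then have "(b * norm x) *\<^sub>R (- e) \<in> K"
      using K b by (intro convex_cone_scaleR) auto
    then have "x + (b * norm x) *\<^sub>R e + (b * norm x) *\<^sub>R (- e) \<in> K"
      using b(2)[of x "b * norm x"] convex_cone_add[OF K(1)] by blast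
    then show False
      using x by simp
  qed
  define C where "C = {k + t *\<^sub>R (- x') |k t. k \<in> K \<and> t \<ge> 0}"
  have C: "convex_cone C" and KC: "K \<subseteq> C"
    unfolding C_def using convex_cone_add_ray[OF K(1)] by blast+
  \<comment> \<open>Otherwise \<open>x'\<close> would be a positive multiple of
    \<open>k + e\<close>, an element of \<open>K\<close>.\<close>
  have neC: "- e \<notin> C"
  proof
    assume "- e \<in> C"
    then obtain k t where kt: "k \<in> K" "t \<ge> 0" "- e = k + t *\<^sub>R (- x')"
      by (auto simp: C_def)
    then have "t \<noteq> 0"
      using ne by auto
    moreover have "t *\<^sub>R x' = k + e"
      using kt(3) by (simp add: algebra_simps)
    ultimately have "x' = (1 / t) *\<^sub>R (k + e)"
      by (metis divide_self_if scaleR_one scaleR_scaleR times_divide_eq_left mult_1)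
    then show False
      using \<epsilon> kt K eK unfolding x'_def by (metis convex_cone_add convex_cone_scaleR divide_nonneg_nonneg zero_le_one)
  qed
  obtain f :: "'a \<Rightarrow>\<^sub>L real" where f: "\<And>x. x \<in> C \<Longrightarrow> f x \<ge> 0" "f e = 1"
    using positive_functional_exists[OF C _ neC] e interior_mono[OF KC] by blast
  have "0 + 1 *\<^sub>R (- x') \<in> C"
    unfolding C_def using K(1) convex_cone_contains_0 by fastforce
  then have "f (- x') \<ge> 0"
    using f(1) by simp
  then have "f x < 0"
    using f(2) \<epsilon>(2)
    by (simp add: x'_def blinfun.add_right blinfun.scaleR_right blinfun.minus_right del: minus_add_distrib)
  moreover have "f \<in> dual_cone K"
    using f(1) KC by (auto simp: dual_cone_def)
  ultimately show thesis
    using that by blast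
qed

text \<open>If \<open>f e \<le> 0\<close>, then adding a large multiple of \<open>e\<close> to
  \<open>z\<close> to reach \<open>K\<close> cannot raise the value of \<open>f\<close>, so
  \<open>f\<close> is nonnegative everywhere and hence zero.\<close>

lemma dual_cone_pos_interior:
  assumes K: "convex_cone K" and e: "e \<in> interior K" and f: "f \<in> dual_cone K" "f \<noteq> 0"
  shows "blinfun_apply f e > 0"
proof (rule ccontr)
  assume "\<not> ?thesis"
  then have fe: "f e \<le> 0" by simp
  obtain b where b: "b > 0" "\<And>z t. b * norm z \<le> t \<Longrightarrow> z + t *\<^sub>R e \<in> K"
    using convex_cone_order_unit[OF K e] by blast
  have ge: "f z \<ge> 0" for z
  proof -
    have "0 \<le> f (z + (b * norm z) *\<^sub>R e)"
      using f(1) b(2)[of z "b * norm z"] by (auto simp: dual_cone_def)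
    also have "\<dots> = f z + (b * norm z) * f e"
      by (simp add: blinfun.add_right blinfun.scaleR_right)
    also have "\<dots> \<le> f z"
      using b(1) fe by (simp add: mult_nonneg_nonpos)
    finally show ?thesis .
  qed
  have "f z = 0" for z
    using ge[of z] ge[of "- z"] by (simp add: blinfun.minus_right)
  then show False
    using f(2) by (auto intro: blinfun_eqI)
qed

section \<open>Weak-star compact convex sets of functionals\<close>

lemma Hausdorff_weak_star: "Hausdorff_space (weak_star_topology :: ('a::real_normed_vector \<Rightarrow>\<^sub>L real) topology)"
  unfolding Hausdorff_space_def
proof (intro allI impI)
  fix f g :: "'a \<Rightarrow>\<^sub>L real"
  assume "f \<in> topspace weak_star_topology \<and> g \<in> topspace weak_star_topology \<and> f \<noteq> g"
  then obtain y where "f y \<noteq> g y"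
    by (metis blinfun_eqI)
  then obtain U V where UV: "open U" "open V" "f y \<in> U" "g y \<in> V" "U \<inter> V = {}"
    by (meson hausdorff)
  have op: "openin weak_star_topology {h :: 'a \<Rightarrow>\<^sub>L real. h y \<in> W}" if "open W" for W
    using openin_continuous_map_preimage[OF strong_operator_topology_continuous_evaluation[of y], of W] that
    by (simp add: strong_operator_topology_topspace)
  show "\<exists>U V. openin weak_star_topology U \<and> openin weak_star_topology V \<and> f \<in> U \<and> g \<in> V \<and> disjnt U V"
    using op[OF UV(1)] op[OF UV(2)] UV(3-5)
    by (intro exI[of _ "{h :: 'a \<Rightarrow>\<^sub>L real. h y \<in> U}"] exI[of _ "{h :: 'a \<Rightarrow>\<^sub>L real. h y \<in> V}"])
      (auto simp: disjnt_def)
qed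

lemma weak_star_closedin_eval:
  "closedin weak_star_topology {f. blinfun_apply f y = c}"
proof -
  have "closedin weak_star_topology {f \<in> topspace weak_star_topology. blinfun_apply f y \<in> {c}}"
    using strong_operator_topology_continuous_evaluation
    by (rule closedin_continuous_map_preimage) simp
  then show ?thesis
    by (simp add: strong_operator_topology_topspace)
qed

lemma weak_star_compact_Int_eval:
  assumes "compactin weak_star_topology C"
  shows "compactin weak_star_topology {g \<in> C. blinfun_apply g y = c}"
  using compact_Int_closedin[OF assms weak_star_closedin_eval[of y c]]
  by (simp add: Int_def)

lemma convex_Int_eval:
  assumes "convex C"
  shows "convex {g \<in> C. blinfun_apply g y = c}"
proof -
  have "convex {g. g \<in> {g. blinfun_apply g y = c}}"
    by (auto simp: convex_def blinfun.add_left blinfun.scaleR_left simp flip: scaleR_left_distrib)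
  then show ?thesis
    using convex_Int[OF assms, of "{g. blinfun_apply g y = c}"] by (simp add: Int_def)
qed

section \<open>Maxima of evaluations, support functions and interpolation\<close>

lemma weak_star_compact_attains_max:
  assumes "compactin weak_star_topology A" "A \<noteq> {}"
  obtains f where "f \<in> A" "\<And>g. g \<in> A \<Longrightarrow> blinfun_apply g y \<le> blinfun_apply f y"
proof -
  have "compact ((\<lambda>f. blinfun_apply f y) ` A)"
    using image_compactin[OF assms(1) strong_operator_topology_continuous_evaluation[of y]] by simp
  then show thesis
    using compact_attains_sup[of "(\<lambda>f. blinfun_apply f y) ` A"] assms(2) that by auto
qed

lemma support_fun_attained:
  assumes "compactin weak_star_topology A" "A \<noteq> {}"
  obtains f where "f \<in> A" "blinfun_apply f y = support_fun A y"
    "\<And>g. g \<in> A \<Longrightarrow> blinfun_apply g y \<le> support_fun A y"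
proof -
  obtain f where f: "f \<in> A" "\<And>g. g \<in> A \<Longrightarrow> blinfun_apply g y \<le> blinfun_apply f y"
    using weak_star_compact_attains_max[OF assms] by blast
  have "support_fun A y = f y"
    unfolding support_fun_def using f by (intro cSup_eq_maximum) auto
  then show thesis
    using f that by simp
qed

lemma support_fun_upper:
  assumes "compactin weak_star_topology A" "f \<in> A"
  shows "blinfun_apply f y \<le> support_fun A y"
  using support_fun_attained[OF assms(1)] assms(2) by blast

text \<open>Adding one vector \<open>v\<close> to \<open>S\<close> amounts to replacing \<open>C\<close> by its slice \<open>g v = \<phi> v\<close>; by a
  separation in the plane, the slice inherits the hypothesis.\<close>

lemma weak_star_compact_interpolation_finite:
  fixes C :: "('a::real_normed_vector \<Rightarrow>\<^sub>L real) set" and \<phi> :: "'a \<Rightarrow> real"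
  assumes "finite S" and "S \<subseteq> V" and V: "subspace V" and \<phi>: "linear \<phi>"
    and "compactin weak_star_topology C" and "convex C"
    and "\<And>y. y \<in> V \<Longrightarrow> \<exists>g\<in>C. \<phi> y \<le> g y"
  shows "\<exists>g\<in>C. \<forall>y\<in>S. g y = \<phi> y"
  using assms(1,2,5-)
proof (induction S arbitrary: C)
  case empty
  then show ?case
    using subspace_0[OF V] by blast
next
  case (insert v S)
  define C' where "C' = {g \<in> C. g v = \<phi> v}"
  have "\<exists>g\<in>C'. \<phi> y \<le> g y" if y: "y \<in> V" for y
  proof (rule ccontr)
    assume contra: "\<not> ?thesis"
    \<comment> \<open>\<open>D\<close> is the planar image of \<open>C\<close> under evaluation at
      \<open>v\<close> and \<open>y\<close>. By \<open>contra\<close> it misses the point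
      \<open>(\<phi> v, \<phi> y)\<close>.\<close>
    define D where "D = (\<lambda>g. (blinfun_apply g v, blinfun_apply g y)) ` C"
    have "continuous_map weak_star_topology (prod_topology euclidean euclidean)
        (\<lambda>g :: 'a \<Rightarrow>\<^sub>L real. (g v, g y))"
      by (simp only: continuous_map_paired strong_operator_topology_continuous_evaluation simp_thms)
    from image_compactin[OF insert.prems(2) this] have "compact D"
      by (simp add: D_def)
    moreover have "linear (\<lambda>g. (blinfun_apply g v, blinfun_apply g y))"
      by (auto intro!: linearI simp: blinfun.add_left blinfun.scaleR_left)
    then have "convex D"
      unfolding D_def using insert.prems(3) by (rule convex_linear_image)
    moreover have "D \<noteq> {}"
      using insert.prems(4)[OF y] by (auto simp: D_def)
    moreover have "D \<inter> {(\<phi> v, \<phi> y)} = {}"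
      using contra by (auto simp: D_def C'_def)
    ultimately obtain w m where
      w: "\<forall>x\<in>D. inner w x < m" "\<forall>x\<in>{(\<phi> v, \<phi> y)}. inner w x > m"
      using separating_hyperplane_compact_closed[of D "{(\<phi> v, \<phi> y)}"] by auto
    \<comment> \<open>The coefficients of the separating line recombine \<open>v\<close> and
      \<open>y\<close> so that evaluation at \<open>u\<close> is the inner product with
      \<open>w\<close>. Then every \<open>g\<close> in \<open>C\<close> has
      \<open>g u < \<phi> u\<close>, against the hypothesis at \<open>u\<close>.\<close>
    define u where "u = fst w *\<^sub>R v + snd w *\<^sub>R y"
    have "u \<in> V"
      using insert.prems(1) y V by (auto simp: u_def intro: subspace_add subspace_scale)
    then obtain g where g: "g \<in> C" "\<phi> u \<le> g u"
      using insert.prems(4) by blast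
    have "\<phi> u = inner w (\<phi> v, \<phi> y)"
      by (simp add: u_def linear_add[OF \<phi>] linear_cmul[OF \<phi>] inner_prod_def)
    moreover have "g u = inner w (g v, g y)"
      by (simp add: u_def blinfun.add_right blinfun.scaleR_right inner_prod_def)
    ultimately show False
      using g w by (force simp: D_def)
  qed
  moreover have "compactin weak_star_topology C'" "convex C'"
    using insert.prems weak_star_compact_Int_eval convex_Int_eval by (auto simp: C'_def)
  ultimately obtain g where "g \<in> C'" "\<forall>y\<in>S. g y = \<phi> y"
    using insert.IH[of C'] insert.prems(1) by blast
  then show ?case
    by (auto simp: C'_def)
qed

text \<open>Each condition \<open>g y = \<phi> y\<close> is weak-star closed, so the finite
  intersection property extends interpolation from finite sets to all of \<open>V\<close>.\<close>

lemma weak_star_compact_interpolation: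
  fixes C :: "('a::real_normed_vector \<Rightarrow>\<^sub>L real) set" and \<phi> :: "'a \<Rightarrow> real"
  assumes C: "compactin weak_star_topology C" "convex C"
    and V: "subspace V" and \<phi>: "linear \<phi>"
    and dom: "\<And>y. y \<in> V \<Longrightarrow> \<exists>g\<in>C. \<phi> y \<le> g y"
  obtains g where "g \<in> C" "\<And>y. y \<in> V \<Longrightarrow> g y = \<phi> y"
proof -
  define E where "E y = {g. blinfun_apply g y = \<phi> y}" for y
  have "C \<inter> \<Inter>(E ` V) \<noteq> {}"
  proof (rule ccontr)
    assume "\<not> ?thesis"
    then have "C \<inter> \<Inter>(E ` V) = {}" by simp
    moreover have "\<forall>X\<in>E ` V. closedin weak_star_topology X"
      using weak_star_closedin_eval by (auto simp: E_def)
    ultimately obtain F where F: "finite F" "F \<subseteq> E ` V" "C \<inter> \<Inter>F = {}"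
      using C(1) unfolding compactin_fip by metis
    then obtain S where "finite S" "S \<subseteq> V" "F = E ` S"
      by (meson finite_subset_image)
    moreover from this obtain g where "g \<in> C" "\<forall>y\<in>S. g y = \<phi> y"
      using weak_star_compact_interpolation_finite[OF _ _ V \<phi> C dom] by blast
    ultimately show False
      using F(3) by (auto simp: E_def)
  qed
  then show thesis
    using that by (auto simp: E_def)
qed

text \<open>Interpolating \<open>f\<close> on the whole space yields an element of \<open>C\<close>
  equal to \<open>f\<close>. This serves as the separation theorem by which support functions
  determine sets.\<close>

lemma mem_weak_star_compact_convex:
  assumes "compactin weak_star_topology C" "convex C" "C \<noteq> {}"
    and "\<And>y. blinfun_apply f y \<le> support_fun C y"
  shows "f \<in> C"
proof -
  have "\<exists>g\<in>C. f y \<le> g y" if "y \<in> UNIV" for y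
    using support_fun_attained[OF assms(1,3), of y] assms(4)[of y] by metis
  then obtain g where "g \<in> C" "\<And>y. g y = f y"
    using weak_star_compact_interpolation[OF assms(1,2) subspace_UNIV
      bounded_linear.linear[OF blinfun.bounded_linear_right[of f]]]
    by (metis UNIV_I)
  then show ?thesis
    using blinfun_eqI[of f g] by simp
qed

section \<open>Sums, star differences and their support functions\<close>

lemma weak_star_continuous_add:
  "continuous_map (prod_topology weak_star_topology weak_star_topology) weak_star_topology
     (\<lambda>(f, g). f + g :: 'a::real_normed_vector \<Rightarrow>\<^sub>L real)"
  unfolding continuous_on_strong_operator_topo_iff_coordinatewise case_prod_unfold blinfun.add_left
proof
  fix y :: 'a
  note eval = strong_operator_topology_continuous_evaluation[of y]
  show "continuous_map (prod_topology weak_star_topology weak_star_topology) euclidean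
      (\<lambda>p. blinfun_apply (fst p) y + blinfun_apply (snd p) y)"
    using continuous_map_add[OF continuous_map_compose[OF continuous_map_fst eval]
      continuous_map_compose[OF continuous_map_snd eval]] by (simp add: comp_def)
qed

lemma weak_star_compact_plus:
  assumes "compactin weak_star_topology A" "compactin weak_star_topology B"
  shows "compactin weak_star_topology (A + B)"
proof -
  have "compactin (prod_topology weak_star_topology weak_star_topology) (A \<times> B)"
    using assms by (simp add: compactin_Times)
  from image_compactin[OF this weak_star_continuous_add] show ?thesis
    by (simp add: set_plus_image)
qed

text \<open>The star difference is the intersection of the translates of \<open>G\<close> by
  \<open>- h\<close>, each compact and therefore closed in the Hausdorff weak-star topology.\<close>

lemma weak_star_compact_star_diff:
  assumes G: "compactin weak_star_topology G" and H: "H \<noteq> {}"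
  shows "compactin weak_star_topology (G \<ominus>\<^sub>* H)"
proof -
  have tr: "compactin weak_star_topology ((\<lambda>g. g + (- h)) ` G)" for h
  proof -
    have "(\<lambda>g. g + (- h)) ` G = G + {- h}"
      by (auto simp: set_plus_def)
    then show ?thesis
      using weak_star_compact_plus[OF G, of "{- h}"] by (simp add: finite_imp_compactin strong_operator_topology_topspace)
  qed
  have "G \<ominus>\<^sub>* H = (\<Inter>h\<in>H. (\<lambda>g. g + (- h)) ` G)"
  proof (rule set_eqI)
    fix f
    have "f \<in> (\<lambda>g. g + (- h)) ` G \<longleftrightarrow> f + h \<in> G" for h
      by (force simp: image_iff algebra_simps)
    then show "f \<in> G \<ominus>\<^sub>* H \<longleftrightarrow> f \<in> (\<Inter>h\<in>H. (\<lambda>g. g + (- h)) ` G)"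
      by (auto simp: star_diff_def)
  qed
  moreover obtain h0 where "h0 \<in> H" using H by blast
  ultimately show ?thesis
    using closed_compactin_Inter[OF tr[of h0], of "(\<lambda>h. (\<lambda>g. g + (- h)) ` G) ` H"]
      compactin_imp_closedin[OF Hausdorff_weak_star tr] by auto
qed

lemma convex_star_diff:
  fixes G :: "'b::real_vector set"
  assumes "convex G"
  shows "convex (G \<ominus>\<^sub>* H)"
proof (rule convexI)
  fix x y and u v :: real
  assume xy: "x \<in> G \<ominus>\<^sub>* H" "y \<in> G \<ominus>\<^sub>* H" and uv: "0 \<le> u" "0 \<le> v" "u + v = 1"
  have "u *\<^sub>R x + v *\<^sub>R y + h \<in> G" if "h \<in> H" for h
  proof -
    have "u *\<^sub>R (x + h) + v *\<^sub>R (y + h) \<in> G"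
      using xy that uv by (intro convexD[OF assms]) (auto simp: star_diff_def)
    also have "u *\<^sub>R (x + h) + v *\<^sub>R (y + h) = u *\<^sub>R x + v *\<^sub>R y + (u + v) *\<^sub>R h"
      by (simp add: algebra_simps)
    finally show ?thesis using uv by simp
  qed
  then show "u *\<^sub>R x + v *\<^sub>R y \<in> G \<ominus>\<^sub>* H"
    by (auto simp: star_diff_def)
qed

text \<open>The sum of a maximizer over \<open>A\<close> and one over \<open>B\<close> is a
  maximizer over \<open>A + B\<close>.\<close>

lemma support_fun_plus:
  assumes A: "compactin weak_star_topology A" "A \<noteq> {}" and B: "compactin weak_star_topology B" "B \<noteq> {}"
  shows "support_fun (A + B) y = support_fun A y + support_fun B y"
proof -
  obtain a where a: "a \<in> A" "blinfun_apply a y = support_fun A y" "\<And>g. g \<in> A \<Longrightarrow> blinfun_apply g y \<le> support_fun A y"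
    using support_fun_attained[OF A] by blast
  obtain b where b: "b \<in> B" "blinfun_apply b y = support_fun B y" "\<And>g. g \<in> B \<Longrightarrow> blinfun_apply g y \<le> support_fun B y"
    using support_fun_attained[OF B] by blast
  have "a + b \<in> A + B"
    using a(1) b(1) by (rule set_plus_intro)
  moreover have "(a + b) y = support_fun A y + support_fun B y"
    using a(2) b(2) by (simp add: blinfun.add_left)
  moreover have "g y \<le> support_fun A y + support_fun B y" if "g \<in> A + B" for g
    using that a(3) b(3) by (auto simp: set_plus_def blinfun.add_left intro!: add_mono)
  ultimately show ?thesis
    unfolding support_fun_def[of "A + B"] by (intro cSup_eq_maximum) force+
qed

text \<open>Through this, the face condition at \<open>y = 0\<close> becomes a condition on the
  whole sets.\<close>

lemma face_zero: "A \<noteq> {} \<Longrightarrow> face A 0 = A"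
  by (auto simp: face_def support_fun_def)

lemma face_singleton: "face {f} y = {f}"
  by (auto simp: face_def support_fun_def)

section \<open>Generators and scalarization pairs\<close>

text \<open>The functional \<open>f\<close> provides a direction of descent: an interior point stays
  nonnegative at \<open>y\<close> after subtracting a small multiple of \<open>f\<close>, so it was
  strictly positive there.\<close>

lemma interior_nonneg_functionals:
  fixes f :: "'a::real_normed_vector \<Rightarrow>\<^sub>L real"
  assumes "f y > 0"
  shows "interior (nonneg_functionals y) = {g. blinfun_apply g y > 0}"
proof (rule antisym)
  have "open {g :: 'a \<Rightarrow>\<^sub>L real. g y > 0}"
    by (intro open_Collect_less continuous_on_const linear_continuous_on blinfun.bounded_linear_left)
  then show "{g. blinfun_apply g y > 0} \<subseteq> interior (nonneg_functionals y)"
    by (intro interior_maximal) (auto simp: nonneg_functionals_def)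
  show "interior (nonneg_functionals y) \<subseteq> {g. blinfun_apply g y > 0}"
  proof
    fix g assume "g \<in> interior (nonneg_functionals y)"
    then obtain r where r: "r > 0" "ball g r \<subseteq> nonneg_functionals y"
      using mem_interior by blast
    have "f \<noteq> 0" using assms by auto
    \<comment> \<open>This multiple of \<open>f\<close> has norm \<open>r / 2\<close>, so
      subtracting it stays in the ball.\<close>
    then have t: "r / (2 * norm f) > 0" "norm f > 0"
      using r by auto
    then have "g - (r / (2 * norm f)) *\<^sub>R f \<in> ball g r"
      using r by (simp add: dist_norm)
    then have "g - (r / (2 * norm f)) *\<^sub>R f \<in> nonneg_functionals y"
      using r by blast
    then have "r / (2 * norm f) * f y \<le> g y"
      by (simp add: nonneg_functionals_def blinfun.diff_left blinfun.scaleR_left)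
    then show "g \<in> {g. blinfun_apply g y > 0}"
      using mult_pos_pos[OF t(1) assms] by simp
  qed
qed

lemma interior_nonneg_functionals_notin_cone:
  fixes K :: "'a::real_normed_vector set"
  assumes K: "convex_cone K" "closed K" "interior K \<noteq> {}" and y: "y \<notin> uminus ` K"
  shows "interior (nonneg_functionals y) = {g. blinfun_apply g y > 0}"
proof -
  obtain e where e: "e \<in> interior K" using K by blast
  have "- y \<notin> K" using y by (metis image_eqI minus_minus)
  then obtain f where "f \<in> dual_cone K" "blinfun_apply f (- y) < 0"
    using dual_cone_separates[OF K(1,2) e] by blast
  then show ?thesis
    using interior_nonneg_functionals[of f y] by (simp add: blinfun.minus_right)
qed

lemma compact_generator_iff:
  fixes K :: "'a::real_normed_vector set"
  assumes K: "convex_cone K" "closed K" "interior K \<noteq> {}"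
    and G: "compactin weak_star_topology G" "convex G" "G \<noteq> {}"
  shows "generator K G \<longleftrightarrow>
    G \<subseteq> dual_cone K \<and> 0 \<notin> G \<and> (\<forall>y. y \<notin> uminus ` K \<longrightarrow> (\<exists>g\<in>G. blinfun_apply g y > 0))"
proof -
  obtain e where e: "e \<in> interior K" using K by blast
  have clG: "weak_star_topology closure_of G = G"
    using compactin_imp_closedin[OF Hausdorff_weak_star G(1)] by (rule closure_of_closedin)
  show ?thesis
  proof (intro iffI conjI allI impI; (elim conjE)?)
    assume gen: "generator K G"
    then have dc: "dual_cone K = {t *\<^sub>R f |t f. t \<ge> 0 \<and> f \<in> G}"
      by (simp add: generator_def)
    show "0 \<notin> G"
      using gen clG by (simp add: generator_def)
    show "G \<subseteq> dual_cone K"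
    proof
      fix g assume "g \<in> G"
      then have "1 *\<^sub>R g \<in> dual_cone K"
        unfolding dc by (metis (mono_tags, lifting) mem_Collect_eq zero_le_one)
      then show "g \<in> dual_cone K" by simp
    qed
    fix y assume "y \<notin> uminus ` K"
    then have "- y \<notin> K" by (metis image_eqI minus_minus)
    then obtain f where f: "f \<in> dual_cone K" "blinfun_apply f (- y) < 0"
      using dual_cone_separates[OF K(1,2) e] by blast
    then obtain t g where "t \<ge> 0" "g \<in> G" "f = t *\<^sub>R g"
      unfolding dc by blast
    moreover from this f have "t * g y > 0"
      by (simp add: blinfun.minus_right blinfun.scaleR_left)
    ultimately show "\<exists>g\<in>G. g y > 0"
      by (metis zero_less_mult_pos less_eq_real_def mult_zero_left less_irrefl)
  next
    assume GK: "G \<subseteq> dual_cone K" and G0: "0 \<notin> G"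
      and pos: "\<forall>y. y \<notin> uminus ` K \<longrightarrow> (\<exists>g\<in>G. blinfun_apply g y > 0)"
    \<comment> \<open>Positivity at \<open>e\<close> allows elements of \<open>G\<close> to be
      compared with \<open>f\<close> by their values at \<open>e\<close>.\<close>
    have ge: "g e > 0" if "g \<in> G" for g
      using dual_cone_pos_interior[OF K(1) e] that GK G0 by blast
    have "\<exists>t g. f = t *\<^sub>R g \<and> t \<ge> 0 \<and> g \<in> G" if f: "f \<in> dual_cone K" for f
    proof (cases "f = 0")
      case True
      then show ?thesis
        using G(3) by (metis ex_in_conv order_refl scaleR_zero_left)
    next
      case False
      then have fe: "f e > 0"
        using dual_cone_pos_interior[OF K(1) e f] by blast
      have sub: "subspace {y. f y = 0}"
        by (auto simp: subspace_def blinfun.add_right blinfun.scaleR_right)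
      \<comment> \<open>This is the hypothesis for interpolating the zero functional on the kernel
        of \<open>f\<close>.\<close>
      have "\<exists>g\<in>G. 0 \<le> g y" if y: "y \<in> {y. f y = 0}" for y
      proof (rule ccontr)
        assume neg: "\<not> ?thesis"
        obtain g1 where g1: "g1 \<in> G" "\<And>g. g \<in> G \<Longrightarrow> g y \<le> g1 y"
          using weak_star_compact_attains_max[OF G(1,3)] by blast
        obtain g2 where g2: "g2 \<in> G" "\<And>g. g \<in> G \<Longrightarrow> g e \<le> g2 e"
          using weak_star_compact_attains_max[OF G(1,3)] by blast
        \<comment> \<open>Chosen so that the maxima over \<open>G\<close> at \<open>y\<close> and at
          \<open>\<epsilon> *\<^sub>R e\<close> cancel. Every \<open>g\<close> in \<open>G\<close>
          is then at most 0 at \<open>y + \<epsilon> *\<^sub>R e\<close>, although \<open>f\<close>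
          is positive there and so keeps this point out of \<open>- K\<close>.\<close>
        define \<epsilon> where "\<epsilon> = - g1 y / g2 e"
        have \<epsilon>: "\<epsilon> > 0"
          using neg g1(1) ge[OF g2(1)] by (auto simp: \<epsilon>_def divide_neg_pos not_le)
        have "f (y + \<epsilon> *\<^sub>R e) > 0"
          using y fe \<epsilon> by (simp add: blinfun.add_right blinfun.scaleR_right)
        then have "y + \<epsilon> *\<^sub>R e \<notin> uminus ` K"
          using f by (force simp: dual_cone_def blinfun.minus_right)
        then obtain g where g: "g \<in> G" "g (y + \<epsilon> *\<^sub>R e) > 0"
          using pos by blast
        have "g (y + \<epsilon> *\<^sub>R e) = g y + \<epsilon> * g e"
          by (simp add: blinfun.add_right blinfun.scaleR_right)
        also have "\<dots> \<le> g1 y + \<epsilon> * g2 e"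
          using g1(2)[OF g(1)] g2(2)[OF g(1)] \<epsilon> by (intro add_mono mult_left_mono) auto
        also have "\<dots> = 0"
          using ge[OF g2(1)] by (simp add: \<epsilon>_def)
        finally show False
          using g(2) by simp
      qed
      then obtain g where g: "g \<in> G" "\<And>y. f y = 0 \<Longrightarrow> g y = 0"
        using weak_star_compact_interpolation[OF G(1,2) sub linear_zero] by auto
      \<comment> \<open>Every \<open>z\<close> differs from a multiple of \<open>e\<close> by a
        kernel vector of \<open>f\<close>, where \<open>g\<close> vanishes too; so \<open>f\<close>
        and \<open>g\<close> are proportional.\<close>
      have fz: "f z = (f e / g e) * g z" for z
      proof -
        have "f (z - (f z / f e) *\<^sub>R e) = 0"
          using fe by (simp add: blinfun.diff_right blinfun.scaleR_right)
        from g(2)[OF this] have "g z = (f z / f e) * g e"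
          by (simp add: blinfun.diff_right blinfun.scaleR_right)
        then show ?thesis
          using fe ge[OF g(1)] by (simp add: field_simps)
      qed
      have "f = (f e / g e) *\<^sub>R g"
        by (rule blinfun_eqI, unfold blinfun.scaleR_left real_scaleR_def, rule fz)
      then show ?thesis
        using g(1) fe ge[OF g(1)] by (metis divide_nonneg_pos less_imp_le)
    qed
    moreover have "t *\<^sub>R g \<in> dual_cone K" if "t \<ge> 0" "g \<in> G" for t g
      using that GK by (auto simp: dual_cone_def blinfun.scaleR_left)
    ultimately have "dual_cone K = {t *\<^sub>R f |t f. t \<ge> 0 \<and> f \<in> G}"
      by blast
    then show "generator K G"
      using G(2) G0 clG by (simp add: generator_def)
  qed
qed

lemma generator_nonempty:
  assumes "generator K G"
  shows "G \<noteq> {}"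
proof -
  have "0 \<in> dual_cone K" by (simp add: dual_cone_def)
  then show ?thesis using assms by (auto simp: generator_def)
qed

lemma compact_generator_iff_scalarization_pair:
  fixes K :: "'a::real_normed_vector set"
  assumes K: "convex_cone K" "closed K" "interior K \<noteq> {}"
    and G: "compactin weak_star_topology G" "convex G" "G \<noteq> {}"
  shows "generator K G \<longleftrightarrow> (G, {0}) \<in> scalarization_pairs K"
proof -
  have "(\<forall>y. set_le (dual_cone K) (face {0} y) (face G y)) \<longleftrightarrow> G \<subseteq> dual_cone K"
  proof
    assume "\<forall>y. set_le (dual_cone K) (face {0} y) (face G y)"
    \<comment> \<open>Specialization to \<open>y = 0\<close>, where both faces are the full
      sets.\<close>
    then have "set_le (dual_cone K) {0} G"
      using face_zero[OF G(3)] face_singleton by metis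
    then show "G \<subseteq> dual_cone K"
      by (auto simp: set_le_def lower_le_def set_plus_def)
  next
    assume GK: "G \<subseteq> dual_cone K"
    show "\<forall>y. set_le (dual_cone K) (face {0} y) (face G y)"
    proof
      fix y
      obtain g where "g \<in> G" "g y = support_fun G y"
        using support_fun_attained[OF G(1,3)] by blast
      then have "g \<in> face G y" "g \<in> dual_cone K"
        using GK by (auto simp: face_def)
      \<comment> \<open>Here \<open>0\<close> is written as \<open>g - g\<close>, with
        \<open>g\<close> both in the face and in the dual cone.\<close>
      then have "0 \<in> face G y \<ominus>\<^sub>M dual_cone K"
        unfolding minkowski_diff_def by force
      moreover have "face G y \<subseteq> {0} + dual_cone K"
        using GK by (auto simp: face_def set_plus_def)
      ultimately show "set_le (dual_cone K) (face {0} y) (face G y)"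
        by (simp add: face_singleton set_le_def lower_le_def upper_le_def)
    qed
  qed
  moreover have "0 \<in> G \<ominus>\<^sub>M interior (nonneg_functionals y) \<longleftrightarrow> (\<exists>g\<in>G. g y > 0)"
    if "y \<notin> uminus ` K" for y
    unfolding interior_nonneg_functionals_notin_cone[OF K that] by (auto simp: minkowski_diff_def)
  moreover have "compactin weak_star_topology {0}"
    by (simp add: finite_imp_compactin strong_operator_topology_topspace)
  ultimately show ?thesis
    unfolding compact_generator_iff[OF K G] scalarization_pairs_def using G by auto
qed

text \<open>The support function of \<open>{0}\<close> vanishes, so the pair \<open>(G, {0})\<close>
  represents \<open>support_fun G\<close>.\<close>

lemma Omega_DS_subset_Omega_QD:
  fixes K :: "'a::real_normed_vector set"
  assumes K: "convex_cone K" "closed K" "interior K \<noteq> {}"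
  shows "Omega_DS K \<subseteq> Omega_QD K"
proof
  fix \<Psi> assume "\<Psi> \<in> Omega_DS K"
  then obtain G where G: "\<Psi> = support_fun G" "compactin weak_star_topology G" "generator K G"
    by (auto simp: Omega_DS_def)
  have "convex G" using G(3) by (simp add: generator_def)
  then have "(G, {0}) \<in> scalarization_pairs K"
    using compact_generator_iff_scalarization_pair[OF K G(2) _ generator_nonempty] G(3) by blast
  moreover have "\<Psi> = (\<lambda>y. support_fun G y - support_fun {0} y)"
    by (rule ext) (simp add: G(1) support_fun_def)
  ultimately show "\<Psi> \<in> Omega_QD K"
    unfolding Omega_QD_def by blast
qed

text \<open>A cancellation law: \<open>H + D\<close> and \<open>G\<close> have the same support
  function and hence coincide, and \<open>H\<close> can then be cancelled in
  \<open>f + h \<in> G\<close> by choosing \<open>h\<close> maximal in each direction.\<close>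

lemma star_diff_eq_if_support_fun_diff:
  assumes G: "compactin weak_star_topology G" "convex G" "G \<noteq> {}"
    and H: "compactin weak_star_topology H" "convex H" "H \<noteq> {}"
    and D: "compactin weak_star_topology D" "convex D" "D \<noteq> {}"
    and eq: "\<And>y. support_fun G y = support_fun H y + support_fun D y"
  shows "G \<ominus>\<^sub>* H = D" and "H + D = G"
proof -
  have HD: "compactin weak_star_topology (H + D)" "convex (H + D)" "H + D \<noteq> {}"
    using weak_star_compact_plus[OF H(1) D(1)] convex_set_plus[OF H(2) D(2)] H(3) D(3)
    by (auto simp: set_plus_def)
  have eq': "support_fun (H + D) y = support_fun G y" for y
    using support_fun_plus[OF H(1,3) D(1,3)] eq by simp
  show HDG: "H + D = G"
  proof (rule antisym; rule subsetI)
    fix f assume "f \<in> H + D"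
    then show "f \<in> G"
      using support_fun_upper[OF HD(1)] eq' mem_weak_star_compact_convex[OF G] by metis
  next
    fix f assume "f \<in> G"
    then show "f \<in> H + D"
      using support_fun_upper[OF G(1)] eq' mem_weak_star_compact_convex[OF HD] by metis
  qed
  show "G \<ominus>\<^sub>* H = D"
  proof (rule antisym; rule subsetI)
    fix d assume "d \<in> D"
    then show "d \<in> G \<ominus>\<^sub>* H"
      using HDG by (auto simp: star_diff_def set_plus_def add.commute)
  next
    fix f assume f: "f \<in> G \<ominus>\<^sub>* H"
    have "f y \<le> support_fun D y" for y
    proof -
      obtain h where h: "h \<in> H" "h y = support_fun H y"
        using support_fun_attained[OF H(1,3)] by blast
      then have "(f + h) y \<le> support_fun G y"
        using f by (intro support_fun_upper[OF G(1)]) (auto simp: star_diff_def)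
      then show ?thesis
        using h eq[of y] by (simp add: blinfun.add_left)
    qed
    then show "f \<in> D"
      by (rule mem_weak_star_compact_convex[OF D])
  qed
qed

text \<open>Each condition on the pair \<open>(G, H)\<close> passes to \<open>G \<ominus>\<^sub>* H\<close> by cancelling \<open>H\<close> at an
  extremal element of \<open>H\<close> for the vector under consideration.\<close>

lemma generator_star_diff:
  fixes K :: "'a::real_normed_vector set"
  assumes K: "convex_cone K" "closed K" "interior K \<noteq> {}"
    and pair: "(G, H) \<in> scalarization_pairs K"
    and sum: "H + (G \<ominus>\<^sub>* H) = G"
  shows "generator K (G \<ominus>\<^sub>* H)"
proof -
  have G: "compactin weak_star_topology G" "convex G" "G \<noteq> {}"
    and H: "compactin weak_star_topology H" "H \<noteq> {}"
    and order: "set_le (dual_cone K) (face H 0) (face G 0)"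
    and disj: "H \<inter> G = {}"
    and cover: "\<And>y. y \<notin> uminus ` K \<Longrightarrow> H \<subseteq> G \<ominus>\<^sub>M interior (nonneg_functionals y)"
    using pair by (auto simp: scalarization_pairs_def)
  define D where "D = G \<ominus>\<^sub>* H"
  have D: "compactin weak_star_topology D" "convex D" "D \<noteq> {}"
    using weak_star_compact_star_diff[OF G(1) H(2)] convex_star_diff[OF G(2)] sum G(3)
    by (auto simp: D_def set_plus_def)
  have GH: "G \<subseteq> H + dual_cone K"
    using order by (simp add: face_zero G H set_le_def lower_le_def)
  have "d y \<ge> 0" if d: "d \<in> D" and y: "y \<in> K" for d y
  proof -
    \<comment> \<open>Maximal at \<open>- y\<close> means minimal at \<open>y\<close>, so
      \<open>d y = (h' y - h y) + k y\<close> is a sum of nonnegative terms.\<close>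
    obtain h where h: "h \<in> H" "\<And>g. g \<in> H \<Longrightarrow> g (- y) \<le> h (- y)"
      using weak_star_compact_attains_max[OF H] by blast
    have "d + h \<in> G"
      using d h(1) by (auto simp: D_def star_diff_def)
    then obtain h' k where "h' \<in> H" "k \<in> dual_cone K" "d + h = h' + k"
      using GH by (auto simp: set_plus_def)
    moreover from this have "d y + h y = h' y + k y"
      by (metis blinfun.add_left)
    ultimately show ?thesis
      using h(2)[of h'] y by (force simp: blinfun.minus_right dual_cone_def)
  qed
  then have "D \<subseteq> dual_cone K"
    by (auto simp: dual_cone_def)
  \<comment> \<open>A zero translation would place the nonempty \<open>H\<close> inside
    \<open>G\<close>.\<close>
  moreover have "0 \<notin> D"
    using disj H(2) by (auto simp: D_def star_diff_def)
  moreover have "\<exists>d\<in>D. d y > 0" if y: "y \<notin> uminus ` K" for y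
  proof -
    \<comment> \<open>For \<open>h\<close> maximal at \<open>y\<close>, writing
      \<open>h + p = g = h' + d\<close> gives \<open>d y \<ge> p y > 0\<close>.\<close>
    obtain h where h: "h \<in> H" "\<And>g. g \<in> H \<Longrightarrow> g y \<le> h y"
      using weak_star_compact_attains_max[OF H] by blast
    then obtain g p where gp: "g \<in> G" "blinfun_apply p y > 0" "h = g - p"
      using cover[OF y] unfolding interior_nonneg_functionals_notin_cone[OF K y]
      by (auto simp: minkowski_diff_def)
    then obtain h' d where "h' \<in> H" "d \<in> D" "g = h' + d"
      using sum unfolding D_def by (metis set_plus_elim)
    then show ?thesis
      using gp h(2)[of h'] by (intro bexI[of _ d]) (auto simp: blinfun.add_left blinfun.diff_left)
  qed
  ultimately show ?thesis
    using compact_generator_iff[OF K D] by (simp add: D_def)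
qed

theorem theorem5p8:
  fixes K :: "'a::banach set"
    and G H :: "('a \<Rightarrow>\<^sub>L real) set"
  assumes "closed K" and "convex K" and "cone K" and "pointed K" and "interior K \<noteq> {}"
    and "G \<noteq> {}" and "compactin weak_star_topology G" and "convex G"
    and "H \<noteq> {}" and "compactin weak_star_topology H" and "convex H"
  shows "((compactin weak_star_topology G \<and> generator K G \<longleftrightarrow> (G, {0}) \<in> scalarization_pairs K)
          \<and> Omega_DS K \<subseteq> Omega_QD K)
       \<and> ((G, H) \<in> scalarization_pairs K \<longrightarrow>
            ((\<lambda>y. support_fun G y - support_fun H y) \<in> Omega_DS K \<longleftrightarrow> H + (G \<ominus>\<^sub>* H) = G)
          \<and> ((\<lambda>y. support_fun G y - support_fun H y) \<in> Omega_DS K \<longrightarrow> generator K (G \<ominus>\<^sub>* H)))"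
proof -
  have "K \<noteq> {}"
    using assms(5) by auto
  then have K: "convex_cone K" "closed K" "interior K \<noteq> {}"
    using assms(1-5) by (auto simp: convex_cone_def cone_def conic_def)
  have i: "compactin weak_star_topology G \<and> generator K G \<longleftrightarrow> (G, {0}) \<in> scalarization_pairs K"
    using compact_generator_iff_scalarization_pair[OF K assms(7,8,6)] assms(7) by simp
  have ds: "H + (G \<ominus>\<^sub>* H) = G \<and> generator K (G \<ominus>\<^sub>* H)"
    if DS: "(\<lambda>y. support_fun G y - support_fun H y) \<in> Omega_DS K"
  proof -
    obtain D where D: "compactin weak_star_topology D" "generator K D"
      "(\<lambda>y. support_fun G y - support_fun H y) = support_fun D"
      using DS by (auto simp: Omega_DS_def)
    have "support_fun G y = support_fun H y + support_fun D y" for y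
      using fun_cong[OF D(3), of y] by simp
    moreover have "convex D"
      using D(2) by (simp add: generator_def)
    \<comment> \<open>Any generator \<open>D\<close> representing the difference is the star
      difference itself, which settles both the sum formula and the generator claim.\<close>
    ultimately have "G \<ominus>\<^sub>* H = D" "H + D = G"
      using star_diff_eq_if_support_fun_diff[OF assms(7,8,6) assms(10,11,9) D(1) _ generator_nonempty[OF D(2)]]
      by blast+
    then show ?thesis
      using D(2) by simp
  qed
  have sd: "(\<lambda>y. support_fun G y - support_fun H y) \<in> Omega_DS K"
    if pair: "(G, H) \<in> scalarization_pairs K" and sum: "H + (G \<ominus>\<^sub>* H) = G"
  proof -
    have c: "compactin weak_star_topology (G \<ominus>\<^sub>* H)"
      using weak_star_compact_star_diff assms(7,9) by blast
    have gen: "generator K (G \<ominus>\<^sub>* H)"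
      by (rule generator_star_diff[OF K pair sum])
    \<comment> \<open>Additivity along \<open>H + (G \<ominus>\<^sub>* H) = G\<close> makes the star
      difference the witness for \<open>Omega_DS K\<close>.\<close>
    have "support_fun G y = support_fun H y + support_fun (G \<ominus>\<^sub>* H) y" for y
      using support_fun_plus[OF assms(10,9) c generator_nonempty[OF gen]] sum by simp
    then have "(\<lambda>y. support_fun G y - support_fun H y) = support_fun (G \<ominus>\<^sub>* H)"
      by auto
    then show ?thesis
      using c gen unfolding Omega_DS_def by blast
  qed
  show ?thesis
    using i Omega_DS_subset_Omega_QD[OF K] ds sd by blast
qed

end
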